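(* Consider, for positive integers $s$, the generalized Pell equation $$X^2-2Y^2=-s^2\qquad\text{with the restriction}\qquad 0<X<Y .$$ Proper solutions ($\gcd(X,Y)=1$) of this equation with the restriction are possible if and only if $s=s(n)$ with $n\ge 2$, where $s(1)<s(2)<\dots$ are the positive integers all of whose prime divisors are congruent to $1$ or $7$ modulo $8$ (OEIS A058529, with $s(1)=1$). In this case $s$, $X$ and $Y$ are odd, and there are exactly $P(n)=2^{P_1(n)+P_7(n)-1}$ solutions, where $P_1(n)$ and $P_7(n)$ are the numbers of distinct prime divisors of $s(n)$ congruent to $1$ and $7$ modulo $8$, respectively. The improper solutions (which are irrelevant here) arise only from composite $s$ with divisors that are primes congruent to $1$ or $7$ modulo $8$. The case $s=1$ does not qualify because there is only one family of solutions (the ambiguous case) with positive proper fundamental solution $(X,Y)=(1,1)$, and positive solutions have $X>Y>0$.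
   Context: All solutions are integer solutions. A solution $(X,Y)$ is called proper if $\gcd(X,Y)=1$ and improper otherwise. Only solutions with $Y>0$ are considered (this can always be reached by a common sign flip of $X$ and $Y$). A family of proper solutions is the infinite set of solutions obtained from one proper solution by applying all integer powers of the map $(X,Y)\mapsto(3X+4Y,\,2X+3Y)$. The conjugate of a family is obtained by $(X,Y)\mapsto(-X,Y)$; a family that coincides with its conjugate is called ambiguous. The positive proper fundamental solution of a family is its positive solution with smallest $X$.
   Formalization: For s=1, "positive solutions have X>Y>0" is proved for all positive solutions except (1,1), where X=Y; for improper solutions, s is shown composite with at least one prime divisor congruent to 1 or 7 mod 8 (not all: s=14 has (2,10)). *)

theory Defs
  imports "HOL-Computational_Algebra.Primes" "HOL-Library.Infinite_Set"
begin

definition pell_solutions :: "nat \<Rightarrow> (int \<times> int) set" where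
  "pell_solutions s = {(X, Y). X\<^sup>2 - 2 * Y\<^sup>2 = - (int s)\<^sup>2 \<and> Y > 0}"

definition proper :: "int \<times> int \<Rightarrow> bool" where
  "proper p \<longleftrightarrow> gcd (fst p) (snd p) = 1"

definition restricted_solutions :: "nat \<Rightarrow> (int \<times> int) set" where
  "restricted_solutions s = {(X, Y) \<in> pell_solutions s. 0 < X \<and> X < Y}"

definition proper_restricted_solutions :: "nat \<Rightarrow> (int \<times> int) set" where
  "proper_restricted_solutions s = {p \<in> restricted_solutions s. proper p}"

definition improper_restricted_solutions :: "nat \<Rightarrow> (int \<times> int) set" where
  "improper_restricted_solutions s = {p \<in> restricted_solutions s. \<not> proper p}"


definition pell_map :: "int \<times> int \<Rightarrow> int \<times> int" where
  "pell_map = (\<lambda>(X, Y). (3 * X + 4 * Y, 2 * X + 3 * Y))"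

lemma bij_pell_map: "bij pell_map"
  by (rule bij_betw_byWitness[where f' = "\<lambda>(X, Y). (3 * X - 4 * Y, 3 * Y - 2 * X)"])
     (auto simp: pell_map_def)

lemma inv_pell_map: "inv pell_map = (\<lambda>(X, Y). (3 * X - 4 * Y, 3 * Y - 2 * X))"
  by (rule inv_unique_comp) (auto simp: pell_map_def fun_eq_iff)

definition pell_map_power :: "int \<Rightarrow> int \<times> int \<Rightarrow> int \<times> int" where
  "pell_map_power k =
     (if k \<ge> 0 then pell_map ^^ nat k else inv pell_map ^^ nat (- k))"

definition families :: "nat \<Rightarrow> (int \<times> int) set set" where
  "families s = {range (\<lambda>k. pell_map_power k p) | p. p \<in> pell_solutions s \<and> proper p}"

definition conjugate :: "(int \<times> int) set \<Rightarrow> (int \<times> int) set" where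
  "conjugate F = (\<lambda>(X, Y). (- X, Y)) ` F"

definition ambiguous :: "(int \<times> int) set \<Rightarrow> bool" where
  "ambiguous F \<longleftrightarrow> conjugate F = F"

definition positive :: "int \<times> int \<Rightarrow> bool" where
  "positive p \<longleftrightarrow> fst p > 0 \<and> snd p > 0"

definition positive_fundamental :: "(int \<times> int) set \<Rightarrow> int \<times> int \<Rightarrow> bool" where
  "positive_fundamental F p \<longleftrightarrow>
     p \<in> F \<and> positive p \<and> (\<forall>q \<in> F. positive q \<longrightarrow> fst p \<le> fst q)"


definition A058529 :: "nat set" where
  "A058529 = {m. m > 0 \<and> (\<forall>p. prime p \<and> p dvd m \<longrightarrow> p mod 8 = 1 \<or> p mod 8 = 7)}"

lemma infinite_A058529: "infinite A058529"
proof -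
  have seven: "prime (7 :: nat)"
    by (simp add: prime_nat_numeral_eq)
  have p7: "p = 7" if "prime p" "p dvd 7 ^ k" for p k :: nat
    using primes_dvd_imp_eq[OF that(1) seven prime_dvd_power[OF that]] .
  have "7 ^ k \<in> A058529" for k
    unfolding A058529_def using p7[of _ k] by (auto dest!: p7)
  then have "range (\<lambda>k. 7 ^ k) \<subseteq> A058529"
    by blast
  moreover have "infinite (range (\<lambda>k. (7 :: nat) ^ k))"
    by (rule range_inj_infinite) (simp add: inj_def)
  ultimately show ?thesis
    using finite_subset by blast
qed

text \<open>
  The increasing enumeration of \<^const>\<open>A058529\<close>, indexed from 1 (whereas
  \<^const>\<open>enumerate\<close> starts at 0); only arguments \<open>n \<ge> 1\<close> are meaningful.
\<close>

definition s_seq :: "nat \<Rightarrow> nat" where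
  "s_seq n = enumerate A058529 (n - 1)"

lemma s_seq_1: "s_seq 1 = 1"
proof -
  have "(1 :: nat) \<in> A058529"
    by (auto simp: A058529_def)
  moreover have "m \<ge> 1" if "m \<in> A058529" for m
    using that by (auto simp: A058529_def)
  ultimately show ?thesis
    unfolding s_seq_def enumerate_0 diff_self_eq_0 by (intro Least_equality) auto
qed

lemma s_seq_less: "1 \<le> m \<Longrightarrow> m < n \<Longrightarrow> s_seq m < s_seq n"
  unfolding s_seq_def by (intro enumerate_mono infinite_A058529) auto

lemma range_s_seq: "s_seq ` {1..} = A058529"
proof -
  have "s_seq ` {1..} = s_seq ` range Suc"
    by (simp add: atLeast_Suc_greaterThan greaterThan_0)
  also have "\<dots> = range (enumerate A058529)"
    by (simp add: image_image s_seq_def)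
  finally show ?thesis
    by (simp add: range_enumerate infinite_A058529)
qed

definition P\<^sub>1 :: "nat \<Rightarrow> nat" where
  "P\<^sub>1 n = card {p. prime p \<and> p dvd s_seq n \<and> p mod 8 = 1}"

definition P\<^sub>7 :: "nat \<Rightarrow> nat" where
  "P\<^sub>7 n = card {p. prime p \<and> p dvd s_seq n \<and> p mod 8 = 7}"

definition P_total :: "nat \<Rightarrow> nat" where
  "P_total n = 2 ^ (P\<^sub>1 n + P\<^sub>7 n - 1)"

end

theory Submission
  imports Defs "HOL-Number_Theory.Gauss"
begin

text \<open>
  The residue of \<open>X / Y\<close> modulo \<open>s\<^sup>2\<close> identifies the primitive solutions of
  \<open>X\<^sup>2 - 2 * Y\<^sup>2 = - s\<^sup>2\<close> in the wedge \<open>\<bar>X\<bar> < Y\<close> with the square roots of \<open>2\<close> modulo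
  \<open>s\<^sup>2\<close> (\<open>card_primitive_wedge\<close>). The wedge is, up to its boundary, a fundamental domain for the
  automorphism \<open>(X, Y) \<mapsto> (3 * X + 4 * Y, 2 * X + 3 * Y)\<close>: the boundary ray \<open>X = - Y\<close> is mapped
  to the boundary ray \<open>X = Y\<close>.

  A root \<open>r\<close> cannot come from two solutions in the wedge: two solutions with the same residue
  differ by a unit of norm one in \<open>\<int>[\<surd>2]\<close>, and being in the wedge forces this unit to be trivial
  (\<open>primitive_wedge_unique\<close>). Every root \<open>r\<close> does come from a solution, because Thue's pigeonhole
  argument gives a nonzero \<open>(x, y)\<close> with \<open>x \<equiv> r * y\<close> and \<open>\<bar>x\<bar>, \<bar>y\<bar> \<le> s\<close>. Then
  \<open>x\<^sup>2 - 2 * y\<^sup>2\<close> is a multiple of \<open>s\<^sup>2\<close> between \<open>- 2 * s\<^sup>2\<close> and \<open>s\<^sup>2\<close>; the extreme values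
  and \<open>0\<close> are impossible, so the norm is \<open>- s\<^sup>2\<close>. Moreover \<open>\<bar>y\<bar> < s\<close> is, for this norm, the
  same as \<open>\<bar>x\<bar> < \<bar>y\<bar>\<close>, so the box of the pigeonhole argument delivers a solution in the wedge
  without any further reduction (\<open>exists_primitive_wedge_of_mod_sqrt\<close>).

  It remains to count roots. By Gauss's lemma \<open>2\<close> is a square modulo an odd prime \<open>p\<close> exactly for
  \<open>p \<equiv> 1, 7 (mod 8)\<close> (\<open>QuadRes_2_iff\<close>); Hensel lifting and the Chinese remainder theorem turn this
  into \<open>2 ^ \<omega>\<close> roots modulo \<open>s\<^sup>2\<close> when all \<open>\<omega>\<close> distinct prime divisors of \<open>s\<close> have this form
  (\<open>card_mod_sqrts_2_A058529\<close>), while any other prime divisor excludes primitive solutions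
  (\<open>A058529_of_primitive_solution\<close>). For \<open>s > 1\<close> the reflection \<open>X \<mapsto> - X\<close> acts without fixed points
  on the wedge, so exactly half of the \<open>2 ^ \<omega>\<close> solutions have \<open>X > 0\<close>.

  Improper solutions reduce to proper ones after division by the greatest common divisor. For
  \<open>s = 1\<close>, descent on \<open>Y\<close> by the automorphism or its inverse leads every solution to
  \<open>(1, 1)\<close>, so that the only family is the set of all solutions
  (\<open>families_1\<close>), which is visibly closed under conjugation.
\<close>

section \<open>Two as a quadratic residue\<close>

text \<open>
  Second supplement to quadratic reciprocity. In Gauss's lemma for the multiplier \<open>2\<close> the products
  \<open>2 * x\<close> with \<open>0 < x \<le> h = (p - 1) / 2\<close> are already reduced modulo \<open>p\<close>, and those exceeding \<open>h\<close>
  are the ones with \<open>x > h div 2\<close>. So the sign is the parity of \<open>h - h div 2\<close>, which depends on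
  \<open>h mod 4\<close>, that is, on \<open>p mod 8\<close>.
\<close>

lemma QuadRes_2_iff:
  fixes p :: nat
  assumes "prime p" "p > 2"
  shows "QuadRes (int p) 2 \<longleftrightarrow> p mod 8 = 1 \<or> p mod 8 = 7"
proof -
  have two: "[2 \<noteq> 0] (mod int p)"
    using assms by (auto simp: cong_0_iff dest: zdvd_imp_le)
  interpret GAUSS p 2
    by unfold_locales (use assms two in auto)
  define h where "h = (int p - 1) div 2"
  have p: "int p = 2 * h + 1"
    using p_eq2 by (simp add: h_def)
  have h: "h > 0"
    using p assms by simp
  have C: "C = (\<lambda>x. 2 * x) ` {0<..h}"
  proof -
    have "C = (\<lambda>x. (x * 2) mod p) ` {0<..h}"
      by (simp add: C_def B_def A_def h_def image_image)
    also have "\<dots> = (\<lambda>x. 2 * x) ` {0<..h}"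
      by (intro image_cong refl) (use p in auto)
    finally show ?thesis .
  qed
  have "E = (\<lambda>x. 2 * x) ` {h div 2<..h}"
    unfolding E_def C h_def[symmetric] using h by auto
  then have "card E = nat (h - h div 2)"
    by (simp add: card_image inj_on_def)
  moreover have "QuadRes (int p) 2 \<longleftrightarrow> Legendre 2 p = 1"
    using two by (simp add: Legendre_def)
  ultimately have "QuadRes (int p) 2 \<longleftrightarrow> even (nat (h - h div 2))"
    using gauss_lemma by (simp add: minus_one_power_iff)
  also have "\<dots> \<longleftrightarrow> even (h - h div 2)"
    using h by (simp add: even_nat_iff)
  also have "\<dots> \<longleftrightarrow> (2 * h + 1) mod 8 = 1 \<or> (2 * h + 1) mod 8 = 7"
  proof -
    define k where "k = h div 4"
    have "h = 4 * k \<or> h = 4 * k + 1 \<or> h = 4 * k + 2 \<or> h = 4 * k + 3"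
      by (simp add: k_def) presburger
    then show ?thesis
      by (elim disjE) (simp_all, presburger+)
  qed
  also have "\<dots> \<longleftrightarrow> int p mod 8 = 1 \<or> int p mod 8 = 7"
    by (simp only: p)
  also have "\<dots> \<longleftrightarrow> p mod 8 = 1 \<or> p mod 8 = 7"
    using of_nat_mod[of p 8, where ?'a = int] by auto
  finally show ?thesis .
qed

section \<open>Counting square roots modulo an integer\<close>

definition mod_sqrts :: "int \<Rightarrow> int \<Rightarrow> int set" where
  "mod_sqrts a m = {r \<in> {0..<m}. [r\<^sup>2 = a] (mod m)}"

lemma mod_in_mod_sqrts: "m > 0 \<Longrightarrow> [r\<^sup>2 = a] (mod m) \<Longrightarrow> r mod m \<in> mod_sqrts a m"
  by (simp add: mod_sqrts_def cong_def power_mod)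

lemma mod_sqrts_eqI:
  "r \<in> mod_sqrts a m \<Longrightarrow> r' \<in> mod_sqrts b m \<Longrightarrow> [r = r'] (mod m) \<Longrightarrow> r = r'"
  by (auto simp: mod_sqrts_def cong_def)

lemma card_mod_sqrts_mult:
  assumes m: "m > 0" and n: "n > 0" and "coprime m n"
  shows "card (mod_sqrts a (m * n)) = card (mod_sqrts a m) * card (mod_sqrts a n)"
proof -
  have "bij_betw (\<lambda>r. (r mod m, r mod n)) (mod_sqrts a (m * n)) (mod_sqrts a m \<times> mod_sqrts a n)"
    unfolding bij_betw_def
  proof
    show "inj_on (\<lambda>r. (r mod m, r mod n)) (mod_sqrts a (m * n))"
    proof (rule inj_onI)
      fix r t assume rt: "r \<in> mod_sqrts a (m * n)" "t \<in> mod_sqrts a (m * n)"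
        and "(r mod m, r mod n) = (t mod m, t mod n)"
      then have "[r = t] (mod m * n)"
        using assms by (intro coprime_cong_mult) (auto simp: cong_def)
      then show "r = t"
        using mod_sqrts_eqI rt by blast
    qed
    show "(\<lambda>r. (r mod m, r mod n)) ` mod_sqrts a (m * n) = mod_sqrts a m \<times> mod_sqrts a n"
    proof safe
      fix r assume "r \<in> mod_sqrts a (m * n)"
      then have r: "[r\<^sup>2 = a] (mod m * n)"
        by (simp add: mod_sqrts_def)
      show "r mod m \<in> mod_sqrts a m" "r mod n \<in> mod_sqrts a n"
        using m n cong_modulus_mult[OF r] cong_modulus_mult[of "r\<^sup>2" a n m] r
        by (auto intro!: mod_in_mod_sqrts simp: mult.commute)
    next
      fix u v assume u: "u \<in> mod_sqrts a m" and v: "v \<in> mod_sqrts a n"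
      obtain x where x: "[x = u] (mod m)" "[x = v] (mod n)"
        using binary_chinese_remainder_int assms by blast
      have "[x\<^sup>2 = a] (mod m * n)"
      proof (rule coprime_cong_mult)
        show "[x\<^sup>2 = a] (mod m)"
          using cong_trans[OF cong_pow[OF x(1)]] u by (auto simp: mod_sqrts_def)
        show "[x\<^sup>2 = a] (mod n)"
          using cong_trans[OF cong_pow[OF x(2)]] v by (auto simp: mod_sqrts_def)
      qed fact
      then have "x mod (m * n) \<in> mod_sqrts a (m * n)"
        using m n by (intro mod_in_mod_sqrts) auto
      moreover have "x mod (m * n) mod m = u" "x mod (m * n) mod n = v"
        using x u v by (auto simp: mod_sqrts_def cong_def mod_mult2_eq mod_mod_cancel)
      ultimately show "(u, v) \<in> (\<lambda>r. (r mod m, r mod n)) ` mod_sqrts a (m * n)"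
        by force
    qed
  qed
  then show ?thesis
    using bij_betw_same_card card_cartesian_product by metis
qed

text \<open>
  Hensel lifting: if \<open>r\<^sup>2 = a + p\<^sup>k * c\<close>, then \<open>r + p\<^sup>k * t\<close> is a root modulo the next power as soon
  as \<open>c + 2 * r * t\<close> is divisible by \<open>p\<close>, and \<open>2 * r\<close> is invertible modulo \<open>p\<close>.
\<close>

lemma QuadRes_prime_power:
  fixes p a :: int
  assumes p: "prime p" "p > 2" and "\<not> p dvd a" "QuadRes p a"
  shows "QuadRes (p ^ Suc k) a"
proof (induction k)
  case 0
  then show ?case using assms by simp
next
  case (Suc k)
  then obtain r where r: "[r\<^sup>2 = a] (mod p ^ Suc k)"
    by (auto simp: QuadRes_def)
  then obtain c where c: "r\<^sup>2 - a = p ^ Suc k * c"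
    by (auto simp: cong_iff_dvd_diff)
  have "\<not> p dvd r"
  proof
    assume "p dvd r"
    then have "p dvd r\<^sup>2 - p ^ Suc k * c"
      by (simp add: power2_eq_square)
    moreover have "r\<^sup>2 - p ^ Suc k * c = a"
      using c by simp
    ultimately show False
      using assms by simp
  qed
  moreover have "\<not> p dvd 2"
    using p by (auto dest: zdvd_imp_le)
  ultimately have "coprime (2 * r) p"
    using p prime_imp_coprime[of p "2 * r"] prime_dvd_mult_iff[of p 2 r]
    by (auto simp: coprime_commute)
  then obtain z where z: "[2 * r * z = 1] (mod p)"
    using cong_solve_coprime_int by blast
  define t where "t = - c * z"
  have "p dvd c + 2 * r * t"
  proof -
    have "p dvd - c * (2 * r * z - 1)"
      using z by (simp add: cong_iff_dvd_diff)
    then show ?thesis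
      by (simp add: t_def algebra_simps)
  qed
  then obtain e where e: "c + 2 * r * t = p * e" ..
  have "(r + p ^ Suc k * t)\<^sup>2 - a = (r\<^sup>2 - a) + p ^ Suc k * (2 * r * t) + (p ^ Suc k * t)\<^sup>2"
    by (simp add: power2_eq_square algebra_simps)
  also have "\<dots> = p ^ Suc k * (c + 2 * r * t) + (p ^ Suc k * t)\<^sup>2"
    by (simp add: c algebra_simps)
  also have "\<dots> = p ^ Suc (Suc k) * (e + p ^ k * t\<^sup>2)"
    unfolding e by (simp add: power2_eq_square algebra_simps)
  finally have "[(r + p ^ Suc k * t)\<^sup>2 = a] (mod p ^ Suc (Suc k))"
    by (simp add: cong_iff_dvd_diff)
  then show ?case
    unfolding QuadRes_def by blast
qed

text \<open>
  The roots are \<open>r\<close> and \<open>- r\<close>: from \<open>p\<^sup>k dvd (t - r) * (t + r)\<close> one factor takes the whole power,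
  since \<open>p\<close> cannot divide both \<open>t - r\<close> and \<open>t + r\<close> without dividing \<open>2 * r\<close>.
\<close>

lemma card_mod_sqrts_prime_power:
  fixes p a :: int
  assumes p: "prime p" "p > 2" and pa: "\<not> p dvd a" "QuadRes p a" and "k > 0"
  shows "card (mod_sqrts a (p ^ k)) = 2"
proof -
  define m where "m = p ^ k"
  have m: "m > 0" "p dvd m"
    using p \<open>k > 0\<close> by (auto simp: m_def)
  obtain r where r: "[r\<^sup>2 = a] (mod m)"
    using QuadRes_prime_power[OF p pa, of "k - 1"] \<open>k > 0\<close> by (auto simp: QuadRes_def m_def)
  have "\<not> p dvd r"
  proof
    assume "p dvd r"
    then have "p dvd r\<^sup>2"
      by (simp add: power2_eq_square)
    moreover have "p dvd r\<^sup>2 - a"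
      using r m dvd_trans by (auto simp: cong_iff_dvd_diff)
    ultimately show False
      using pa dvd_diff[of p "r\<^sup>2" "r\<^sup>2 - a"] by simp
  qed
  moreover have p2: "\<not> p dvd 2"
    using p by (auto dest: zdvd_imp_le)
  ultimately have p2r: "\<not> p dvd 2 * r"
    using p by (simp add: prime_dvd_mult_iff)
  have "mod_sqrts a m = {r mod m, (- r) mod m}"
  proof (intro equalityI subsetI)
    fix t assume t: "t \<in> mod_sqrts a m"
    then have "[t\<^sup>2 = r\<^sup>2] (mod m)"
      using r by (auto simp: mod_sqrts_def intro: cong_trans cong_sym)
    then have dvd: "m dvd (t - r) * (t + r)"
      by (simp add: cong_iff_dvd_diff power2_eq_square algebra_simps)
    have "[t = r] (mod m) \<or> [t = - r] (mod m)"
    proof (cases "p dvd t - r")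
      case True
      then have "\<not> p dvd t + r"
        using p2r dvd_diff[of p "t + r" "t - r"] by auto
      then have "coprime m (t + r)"
        unfolding m_def using p by (intro coprime_power_left_iff[THEN iffD2]) (auto intro: prime_imp_coprime)
      then show ?thesis
        using dvd by (simp add: cong_iff_dvd_diff coprime_dvd_mult_left_iff)
    next
      case False
      then have "coprime m (t - r)"
        unfolding m_def using p by (intro coprime_power_left_iff[THEN iffD2]) (auto intro: prime_imp_coprime)
      then show ?thesis
        using dvd by (simp add: cong_iff_dvd_diff coprime_dvd_mult_right_iff)
    qed
    then show "t \<in> {r mod m, (- r) mod m}"
      using t by (auto simp: mod_sqrts_def cong_def)
  next
    fix t assume "t \<in> {r mod m, (- r) mod m}"
    then show "t \<in> mod_sqrts a m"
      using mod_in_mod_sqrts[OF m(1)] r by auto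
  qed
  moreover have "r mod m \<noteq> (- r) mod m"
  proof
    assume "r mod m = (- r) mod m"
    then have "m dvd r - (- r)"
      by (simp only: mod_eq_dvd_iff)
    then show False
      using p2r m dvd_trans by auto
  qed
  ultimately show ?thesis
    by (simp add: m_def)
qed

lemma card_mod_sqrts_prod_prime_powers:
  fixes a :: int and e :: "nat \<Rightarrow> nat"
  assumes "finite S"
    and "\<And>p. p \<in> S \<Longrightarrow> prime p \<and> p > 2 \<and> \<not> int p dvd a \<and> QuadRes (int p) a \<and> e p > 0"
  shows "card (mod_sqrts a (\<Prod>p\<in>S. int p ^ e p)) = 2 ^ card S"
  using assms
proof (induction S rule: finite_induct)
  case empty
  have "mod_sqrts a 1 = {0}"
    by (auto simp: mod_sqrts_def)
  then show ?case by simp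
next
  case (insert p S)
  have "coprime (int p) (int q)" if "q \<in> S" for q
    using insert that primes_coprime[of p q] by auto
  then have "coprime (int p ^ e p) (\<Prod>q\<in>S. int q ^ e q)"
    by (intro prod_coprime_right) simp
  moreover have "(\<Prod>q\<in>S. int q ^ e q) > 0"
    using insert.prems by (intro prod_pos) (auto simp: prime_gt_0_nat)
  moreover have "int p ^ e p > 0"
    using insert.prems by (auto simp: prime_gt_0_nat)
  ultimately have "card (mod_sqrts a (\<Prod>q\<in>insert p S. int q ^ e q))
      = card (mod_sqrts a (int p ^ e p)) * card (mod_sqrts a (\<Prod>q\<in>S. int q ^ e q))"
    using insert.hyps by (simp add: card_mod_sqrts_mult)
  also have "\<dots> = 2 * 2 ^ card S"
    using insert by (subst card_mod_sqrts_prime_power) auto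
  finally show ?case
    using insert.hyps by simp
qed

lemma card_mod_sqrts_2_A058529:
  assumes "s \<in> A058529"
  shows "card (mod_sqrts 2 ((int s)\<^sup>2)) = 2 ^ card (prime_factors s)"
proof -
  have "s > 0"
    using assms by (simp add: A058529_def)
  have "int s = (\<Prod>p\<in>prime_factors s. int p ^ multiplicity p s)"
    using arg_cong[OF prime_factorization_nat[OF \<open>s > 0\<close>], of int] by simp
  then have "(int s)\<^sup>2 = (\<Prod>p\<in>prime_factors s. int p ^ multiplicity p s)\<^sup>2"
    by (rule arg_cong)
  also have "\<dots> = (\<Prod>p\<in>prime_factors s. int p ^ (2 * multiplicity p s))"
    by (simp add: prod_power_distrib power_even_eq)
  finally have "(int s)\<^sup>2 = (\<Prod>p\<in>prime_factors s. int p ^ (2 * multiplicity p s))" .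
  moreover have "card (mod_sqrts 2 (\<Prod>p\<in>prime_factors s. int p ^ (2 * multiplicity p s)))
      = 2 ^ card (prime_factors s)"
  proof (rule card_mod_sqrts_prod_prime_powers)
    fix p assume p: "p \<in> prime_factors s"
    then have "prime p" "p dvd s"
      by auto
    with assms have p8: "p mod 8 = 1 \<or> p mod 8 = 7"
      by (simp add: A058529_def)
    have "p \<noteq> 2"
      using p8 by auto
    then have "p > 2"
      using \<open>prime p\<close> prime_ge_2_nat[of p] by simp
    moreover have "\<not> int p dvd 2"
      using \<open>p > 2\<close> by (auto dest: zdvd_imp_le)
    ultimately show "prime p \<and> p > 2 \<and> \<not> int p dvd 2 \<and> QuadRes (int p) 2 \<and> 2 * multiplicity p s > 0"
      using QuadRes_2_iff[of p] p8 \<open>prime p\<close> p by (auto simp: prime_factors_multiplicity)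
  qed simp
  ultimately show ?thesis
    by simp
qed


section \<open>Solutions as square roots of two\<close>

text \<open>
  Thue's lemma: the \<open>(b + 1)\<^sup>2 > m\<close> values \<open>u - r * v\<close> with \<open>0 \<le> u, v \<le> b\<close> cannot be distinct
  modulo \<open>m\<close>, and the difference of two colliding pairs is the required \<open>(x, y)\<close>.
\<close>

lemma thue:
  fixes r m b :: int
  assumes m: "m > 0" "m < (b + 1)\<^sup>2" and "b \<ge> 0"
  obtains x y where "[x = r * y] (mod m)" "\<bar>x\<bar> \<le> b" "\<bar>y\<bar> \<le> b" "(x, y) \<noteq> (0, 0)"
proof -
  define f where "f = (\<lambda>(u, v). (u - r * v) mod m)"
  define B where "B = {0..b} \<times> {0..b}"
  have "f ` B \<subseteq> {0..<m}"
    using m by (auto simp: f_def)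
  then have "card (f ` B) \<le> card {0..<m}"
    by (intro card_mono) auto
  also have "\<dots> < card B"
  proof -
    have "int (nat m) < int (nat (b + 1) * nat (b + 1))"
      using assms by (simp add: power2_eq_square)
    then have "nat m < nat (b + 1) * nat (b + 1)"
      by (simp only: of_nat_less_iff)
    then show ?thesis
      by (simp add: B_def card_cartesian_product)
  qed
  finally have "\<not> inj_on f B"
    using pigeonhole by blast
  then obtain u v u' v' where uv: "(u, v) \<in> B" "(u', v') \<in> B" "(u, v) \<noteq> (u', v')"
      "f (u, v) = f (u', v')"
    by (auto simp: inj_on_def)
  have "m dvd (u - r * v) - (u' - r * v')"
    using uv(4) by (simp add: f_def mod_eq_dvd_iff)
  then have "[u - u' = r * (v - v')] (mod m)"
    by (simp add: cong_iff_dvd_diff algebra_simps)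
  then show ?thesis
    using uv by (intro that[of "u - u'" "v - v'"]) (auto simp: B_def)
qed

text \<open>
  Irrationality of \<open>\<surd>2\<close>, by parity of the exponent of \<open>2\<close> on both sides.
\<close>

lemma square_eq_two_times_square:
  fixes x y :: int
  assumes "x\<^sup>2 = 2 * y\<^sup>2"
  shows "y = 0"
proof (rule ccontr)
  assume y: "y \<noteq> 0"
  then have x: "x \<noteq> 0"
    using assms by auto
  have "2 * multiplicity 2 x = multiplicity 2 (x\<^sup>2)"
    using x by (simp add: prime_elem_multiplicity_power_distrib)
  also have "\<dots> = 1 + 2 * multiplicity 2 y"
    using y by (simp add: assms prime_elem_multiplicity_mult_distrib prime_elem_multiplicity_power_distrib)
  finally show False
    by presburger
qed

text \<open>
  The strict inequality loses no primitive solution with \<open>s > 1\<close>: on the boundary \<open>\<bar>X\<bar> = Y\<close> the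
  equation gives \<open>Y = s\<close>, whence \<open>s\<close> divides both coordinates.
\<close>

definition primitive_wedge :: "int \<Rightarrow> (int \<times> int) set" where
  "primitive_wedge s = {(X, Y). X\<^sup>2 - 2 * Y\<^sup>2 = - s\<^sup>2 \<and> coprime X Y \<and> \<bar>X\<bar> < Y}"

lemma wedge_bound:
  fixes X Y s :: int
  assumes "X\<^sup>2 - 2 * Y\<^sup>2 = - s\<^sup>2" "\<bar>X\<bar> < Y" "s > 0"
  shows "Y < s"
proof -
  have "X\<^sup>2 < Y\<^sup>2"
    using assms power_strict_mono[of "\<bar>X\<bar>" Y 2] by simp
  then have "Y\<^sup>2 < s\<^sup>2"
    using assms by simp
  then show ?thesis
    using \<open>s > 0\<close> by (simp add: power2_less_imp_less)
qed

text \<open>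
  Let \<open>g\<close> be the gcd and \<open>n = (s / g)\<^sup>2\<close>, so that \<open>s\<^sup>2 = g\<^sup>2 * n\<close>. Dividing the congruence
  by \<open>g\<close> leaves \<open>x \<equiv> r * y\<close> modulo \<open>g * n\<close>, so \<open>g * n\<close> divides the norm \<open>- n\<close> of \<open>(x, y)\<close>.
\<close>

lemma coprime_mod_solution:
  fixes X Y r s :: int
  assumes eq: "X\<^sup>2 - 2 * Y\<^sup>2 = - s\<^sup>2" and "s \<noteq> 0"
    and X: "[X = r * Y] (mod s\<^sup>2)" and r: "[r\<^sup>2 = 2] (mod s\<^sup>2)"
  shows "coprime X Y"
proof -
  define g where "g = gcd X Y"
  obtain x y where xy: "X = g * x" "Y = g * y"
    unfolding g_def by (meson dvdE gcd_dvd1 gcd_dvd2)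
  have "Y \<noteq> 0"
  proof
    assume "Y = 0"
    then have "X\<^sup>2 + s\<^sup>2 = 0"
      using eq by simp
    then show False
      using \<open>s \<noteq> 0\<close> by (simp add: sum_power2_eq_zero_iff)
  qed
  then have "g > 0"
    by (simp add: g_def)
  have "g\<^sup>2 * (2 * y\<^sup>2 - x\<^sup>2) = s\<^sup>2"
    using eq by (simp add: xy power_mult_distrib algebra_simps)
  then obtain n where n: "n = 2 * y\<^sup>2 - x\<^sup>2" "s\<^sup>2 = g * (g * n)"
    by (simp add: power2_eq_square mult.assoc)
  have "n \<noteq> 0"
    using n \<open>s \<noteq> 0\<close> by auto
  have "g * (g * n) dvd g * (x - r * y)"
    using X by (simp add: n(2) xy cong_iff_dvd_diff algebra_simps)
  then have "g * n dvd x - r * y"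
    using \<open>g > 0\<close> by simp
  then have "g * n dvd (x - r * y) * (x + r * y)"
    by simp
  moreover have "g * n dvd r\<^sup>2 - 2"
    using r unfolding n(2) cong_iff_dvd_diff by (rule dvd_mult_right)
  then have "g * n dvd (r\<^sup>2 - 2) * y\<^sup>2"
    by simp
  ultimately have "g * n dvd (x - r * y) * (x + r * y) + (r\<^sup>2 - 2) * y\<^sup>2"
    by (rule dvd_add)
  also have "(x - r * y) * (x + r * y) + (r\<^sup>2 - 2) * y\<^sup>2 = - n"
    by (simp add: n(1) power2_eq_square algebra_simps)
  finally have "g * n dvd 1 * n"
    by simp
  then have "g dvd 1"
    using \<open>n \<noteq> 0\<close> dvd_mult_cancel_right[of g n 1] by simp
  then show ?thesis
    by (simp add: g_def coprime_iff_gcd_eq_1)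
qed

text \<open>
  The bound \<open>s\<close> in Thue's lemma is exactly the square root of the modulus, so the norm of \<open>(x, y)\<close>
  could a priori sit on the boundary of the interval from \<open>- 2 * s\<^sup>2\<close> to \<open>s\<^sup>2\<close>. Excluding
  \<open>\<bar>y\<bar> = s\<close> removes the lower end and at the same time puts the solution inside the wedge.
\<close>

lemma exists_primitive_wedge_of_mod_sqrt:
  fixes r s :: int
  assumes s: "s > 1" and r: "[r\<^sup>2 = 2] (mod s\<^sup>2)"
  shows "\<exists>(X, Y) \<in> primitive_wedge s. [X = r * Y] (mod s\<^sup>2)"
proof -
  have r2: "s dvd r\<^sup>2 - 2"
    using r by (auto simp: cong_iff_dvd_diff power2_eq_square dest: dvd_mult_left)
  have s2: "s < s\<^sup>2"
    using s by (simp add: power2_eq_square)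
  obtain x y where xy: "[x = r * y] (mod s\<^sup>2)" "\<bar>x\<bar> \<le> s" "\<bar>y\<bar> \<le> s" "(x, y) \<noteq> (0, 0)"
    using thue[of "s\<^sup>2" s r] s by (auto simp: power2_eq_square algebra_simps)
  have "y \<noteq> 0"
  proof
    assume "y = 0"
    then have "s\<^sup>2 dvd x" "x \<noteq> 0"
      using xy by (auto simp: cong_iff_dvd_diff)
    then have "s\<^sup>2 \<le> \<bar>x\<bar>"
      using zdvd_imp_le[of "s\<^sup>2" "\<bar>x\<bar>"] by simp
    then show False
      using xy s2 by simp
  qed
  \<comment> \<open>A common change of sign makes the second coordinate positive and keeps the congruence.\<close>
  define X Y where "X = sgn y * x" and "Y = \<bar>y\<bar>"
  have Y: "0 < Y" "Y \<le> s" and Xs: "\<bar>X\<bar> \<le> s"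
    using xy \<open>y \<noteq> 0\<close> by (auto simp: X_def Y_def abs_mult)
  have "[sgn y * x = sgn y * (r * y)] (mod s\<^sup>2)"
    using xy(1) by (rule cong_scalar_left)
  then have XY: "[X = r * Y] (mod s\<^sup>2)"
    by (simp add: X_def Y_def abs_sgn mult_ac)
  have "Y \<noteq> s"
  proof
    \<comment> \<open>Then \<open>X = s * t\<close> with \<open>t \<in> {-1, 0, 1}\<close> and \<open>r \<equiv> t (mod s)\<close>. For \<open>t = 0\<close> this makes \<open>s\<^sup>2\<close>
      divide \<open>2\<close>; for \<open>t = 1, -1\<close> both \<open>r\<^sup>2 - 1\<close> and \<open>r\<^sup>2 - 2\<close> are divisible by \<open>s\<close>.\<close>
    assume "Y = s"
    have "s dvd X - r * s"
      using XY by (auto simp: \<open>Y = s\<close> cong_iff_dvd_diff power2_eq_square dest: dvd_mult_left)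
    then have "s dvd X"
      using dvd_add[of s "X - r * s" "r * s"] by simp
    then obtain t where t: "X = s * t" ..
    have "s * s dvd s * (t - r)"
      using XY by (simp add: \<open>Y = s\<close> t cong_iff_dvd_diff power2_eq_square algebra_simps)
    then have "s dvd t - r"
      using s by simp
    have "\<bar>t\<bar> \<le> 1"
      using Xs s by (simp add: t abs_mult)
    then have "t = 0 \<or> t\<^sup>2 = 1"
      by (auto simp: abs_le_iff power2_eq_1_iff)
    then show False
    proof
      assume "t = 0"
      then have "s\<^sup>2 dvd r\<^sup>2"
        using \<open>s dvd t - r\<close> by simp
      then have "s\<^sup>2 dvd r\<^sup>2 - (r\<^sup>2 - 2)"
        using r unfolding cong_iff_dvd_diff by (rule dvd_diff)
      then have "s\<^sup>2 \<le> 2"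
        by (auto dest: zdvd_imp_le)
      then show False
        using s2 s by simp
    next
      assume "t\<^sup>2 = 1"
      have "s dvd (t - r) * (t + r) + (r\<^sup>2 - 2)"
        using \<open>s dvd t - r\<close> r2 by simp
      also have "(t - r) * (t + r) + (r\<^sup>2 - 2) = t\<^sup>2 - 2"
        by (simp add: power2_eq_square algebra_simps)
      finally show False
        using s \<open>t\<^sup>2 = 1\<close> by simp
    qed
  qed
  with Y have "Y < s"
    by simp
  have "s\<^sup>2 dvd X\<^sup>2 - 2 * Y\<^sup>2"
  proof -
    have "s\<^sup>2 dvd (X - r * Y) * (X + r * Y) + (r\<^sup>2 - 2) * Y\<^sup>2"
      using XY r unfolding cong_iff_dvd_diff by (intro dvd_add) (simp_all only: dvd_mult2)
    then show ?thesis
      by (simp add: power2_eq_square algebra_simps)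
  qed
  then obtain q where q: "X\<^sup>2 - 2 * Y\<^sup>2 = s\<^sup>2 * q" ..
  have "X\<^sup>2 \<le> s\<^sup>2"
    using Xs s by (simp add: abs_le_square_iff[symmetric])
  moreover have "Y\<^sup>2 < s\<^sup>2"
    using Y \<open>Y < s\<close> by (intro power_strict_mono) auto
  moreover have "Y\<^sup>2 > 0" "X\<^sup>2 \<ge> 0"
    using Y by auto
  ultimately have "s\<^sup>2 * q < s\<^sup>2 * 1" "s\<^sup>2 * (- 2) < s\<^sup>2 * q"
    using q by linarith+
  then have "q < 1" "- 2 < q"
    using s by (simp_all only: mult_less_cancel_left_pos zero_less_power)
  moreover have "q \<noteq> 0"
    using q Y square_eq_two_times_square[of X Y] by auto
  ultimately have "q = - 1"
    by simp
  then have eq: "X\<^sup>2 - 2 * Y\<^sup>2 = - s\<^sup>2"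
    using q by simp
  then have "X\<^sup>2 < Y\<^sup>2"
    using \<open>Y\<^sup>2 < s\<^sup>2\<close> by simp
  then have "\<bar>X\<bar> < Y"
    using Y by (intro power2_less_imp_less[of "\<bar>X\<bar>"]) auto
  then have "(X, Y) \<in> primitive_wedge s"
    using eq coprime_mod_solution[OF eq _ XY r] s by (auto simp: primitive_wedge_def)
  then show ?thesis
    using XY by blast
qed

text \<open>
  Write \<open>\<alpha> = X + Y * \<surd>2\<close> and \<open>\<beta> = Z - W * \<surd>2\<close>. The congruences make both coordinates of
  \<open>\<alpha> * \<beta>\<close> divisible by \<open>s\<^sup>2\<close>, and its norm is \<open>s\<^sup>4\<close>, so \<open>\<alpha> * \<beta> = s\<^sup>2 * (t - u * \<surd>2)\<close> with
  \<open>t\<^sup>2 - 2 * u\<^sup>2 = 1\<close>. The wedge bounds give \<open>\<bar>u\<bar> < 2\<close>, and \<open>u = 1\<close> or \<open>u = -1\<close> would need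
  \<open>t\<^sup>2 = 3\<close>. Hence \<open>X / Y = Z / W\<close>, two fractions in lowest terms.
\<close>

lemma primitive_wedge_unique:
  fixes X Y Z W s r :: int
  assumes s: "s > 0" and XY: "(X, Y) \<in> primitive_wedge s" and ZW: "(Z, W) \<in> primitive_wedge s"
    and X: "[X = r * Y] (mod s\<^sup>2)" and Z: "[Z = r * W] (mod s\<^sup>2)" and r: "[r\<^sup>2 = 2] (mod s\<^sup>2)"
  shows "X = Z \<and> Y = W"
proof -
  have XY': "X\<^sup>2 - 2 * Y\<^sup>2 = - s\<^sup>2" "coprime X Y" "\<bar>X\<bar> < Y"
    and ZW': "Z\<^sup>2 - 2 * W\<^sup>2 = - s\<^sup>2" "coprime Z W" "\<bar>Z\<bar> < W"
    using XY ZW by (auto simp: primitive_wedge_def)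
  have Ys: "Y < s" and Ws: "W < s"
    using wedge_bound XY' ZW' s by blast+
  have d: "s\<^sup>2 dvd X - r * Y" "s\<^sup>2 dvd Z - r * W" "s\<^sup>2 dvd r\<^sup>2 - 2"
    using X Z r by (auto simp: cong_iff_dvd_diff)
  have "s\<^sup>2 dvd (X - r * Y) * W - (Z - r * W) * Y"
    using d by (intro dvd_diff) (simp_all only: dvd_mult2)
  then have "s\<^sup>2 dvd X * W - Y * Z"
    by (simp add: algebra_simps)
  then obtain u where u: "X * W - Y * Z = s\<^sup>2 * u" ..
  have "s\<^sup>2 dvd (X - r * Y) * Z + (Z - r * W) * (r * Y) + (r\<^sup>2 - 2) * (Y * W)"
    using d by (intro dvd_add) (simp_all only: dvd_mult2)
  then have "s\<^sup>2 dvd X * Z - 2 * Y * W"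
    by (simp add: algebra_simps power2_eq_square)
  then obtain t where t: "X * Z - 2 * Y * W = s\<^sup>2 * t" ..
  have "\<bar>X * W - Y * Z\<bar> \<le> \<bar>X * W\<bar> + \<bar>Y * Z\<bar>"
    by simp
  also have "\<dots> < s * s + s * s"
  proof (rule add_strict_mono)
    show "\<bar>X * W\<bar> < s * s" "\<bar>Y * Z\<bar> < s * s"
      unfolding abs_mult using XY' ZW' Ys Ws by (auto intro!: mult_strict_mono)
  qed
  also have "\<dots> = s\<^sup>2 * 2"
    by (simp add: power2_eq_square)
  finally have "s\<^sup>2 * \<bar>u\<bar> < s\<^sup>2 * 2"
    by (simp add: u abs_mult)
  then have "\<bar>u\<bar> < 2"
    using s by simp
  have "s\<^sup>2 * s\<^sup>2 * (t\<^sup>2 - 2 * u\<^sup>2) = (s\<^sup>2 * t)\<^sup>2 - 2 * (s\<^sup>2 * u)\<^sup>2"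
    by (simp add: power2_eq_square algebra_simps)
  also have "\<dots> = (X\<^sup>2 - 2 * Y\<^sup>2) * (Z\<^sup>2 - 2 * W\<^sup>2)"
    unfolding t[symmetric] u[symmetric] by (simp add: power2_eq_square algebra_simps)
  also have "\<dots> = s\<^sup>2 * s\<^sup>2 * 1"
    using XY' ZW' by simp
  finally have tu: "t\<^sup>2 - 2 * u\<^sup>2 = 1"
    using s by simp
  have "u = 0"
  proof (rule ccontr)
    assume "u \<noteq> 0"
    then have "u = 1 \<or> u = - 1"
      using \<open>\<bar>u\<bar> < 2\<close> by auto
    then have "t\<^sup>2 = 3"
      using tu by auto
    then have "\<bar>t\<bar> < 2"
      by (intro power2_less_imp_less[of "\<bar>t\<bar>"]) auto
    then have "t = 0 \<or> t = 1 \<or> t = - 1"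
      by auto
    then show False
      using \<open>t\<^sup>2 = 3\<close> by auto
  qed
  then have XW: "X * W = Y * Z"
    using u by simp
  have "Y dvd W"
    using XW XY'(2) by (metis coprime_commute coprime_dvd_mult_right_iff dvd_triv_left)
  moreover have "W dvd Y"
    using XW ZW'(2) by (metis coprime_commute coprime_dvd_mult_left_iff dvd_triv_right)
  ultimately have "Y = W"
    using XY' ZW' by (auto intro: zdvd_antisym_nonneg)
  then show ?thesis
    using XW XY' by auto
qed

lemma coprime_snd_norm:
  fixes X Y s :: int
  assumes "X\<^sup>2 - 2 * Y\<^sup>2 = - s\<^sup>2" "coprime X Y"
  shows "coprime Y s"
proof (rule coprimeI)
  fix c assume c: "c dvd Y" "c dvd s"
  then have "c dvd 2 * Y\<^sup>2 - s\<^sup>2"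
    by (simp add: power2_eq_square)
  also have "2 * Y\<^sup>2 - s\<^sup>2 = X\<^sup>2"
    using assms by simp
  finally have "c dvd X\<^sup>2" .
  moreover have "coprime (X\<^sup>2) Y"
    using assms by simp
  ultimately show "is_unit c"
    using c(1) by (meson coprime_common_divisor)
qed

text \<open>
  The root is \<open>X / Y\<close> modulo \<open>m\<close>. It is taken modulo \<open>s\<^sup>2\<close> for the count of solutions, and modulo
  a prime divisor of \<open>s\<close> for the necessary condition on \<open>s\<close>.
\<close>

lemma exists_mod_sqrt_of_solution:
  fixes X Y s m :: int
  assumes eq: "X\<^sup>2 - 2 * Y\<^sup>2 = - s\<^sup>2" and "coprime Y m" and "m dvd s\<^sup>2" and "m > 0"
  shows "\<exists>r \<in> mod_sqrts 2 m. [X = r * Y] (mod m)"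
proof -
  obtain z where z: "[Y * z = 1] (mod m)"
    using cong_solve_coprime_int \<open>coprime Y m\<close> by blast
  have "m dvd X\<^sup>2 - 2 * Y\<^sup>2"
    using eq \<open>m dvd s\<^sup>2\<close> by simp
  then have "[X\<^sup>2 = 2 * Y\<^sup>2] (mod m)"
    by (simp add: cong_iff_dvd_diff)
  then have "[X\<^sup>2 * z\<^sup>2 = 2 * Y\<^sup>2 * z\<^sup>2] (mod m)"
    by (rule cong_scalar_right)
  then have "[(X * z)\<^sup>2 = 2 * (Y * z)\<^sup>2] (mod m)"
    by (simp add: power_mult_distrib mult.assoc)
  moreover have "[2 * (Y * z)\<^sup>2 = 2 * 1\<^sup>2] (mod m)"
    using z by (intro cong_scalar_left cong_pow)
  ultimately have "[(X * z)\<^sup>2 = 2] (mod m)"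
    using cong_trans by fastforce
  then have "(X * z) mod m \<in> mod_sqrts 2 m"
    using \<open>m > 0\<close> by (intro mod_in_mod_sqrts)
  moreover have "[X * z mod m * Y = X * z * Y] (mod m)"
    by (simp only: cong_def mod_mult_left_eq)
  then have "[X * z mod m * Y = X * (Y * z)] (mod m)"
    by (simp only: mult_ac)
  then have "[X * z mod m * Y = X] (mod m)"
    using cong_scalar_left[OF z, of X] cong_trans by fastforce
  ultimately show ?thesis
    using cong_sym by blast
qed

lemma card_primitive_wedge:
  fixes s :: int
  assumes "s > 1"
  shows "card (primitive_wedge s) = card (mod_sqrts 2 (s\<^sup>2))"
proof -
  have ex: "\<exists>r. r \<in> mod_sqrts 2 (s\<^sup>2) \<and> [fst p = r * snd p] (mod s\<^sup>2)"
    if "p \<in> primitive_wedge s" for p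
  proof -
    have p: "(fst p)\<^sup>2 - 2 * (snd p)\<^sup>2 = - s\<^sup>2" "coprime (fst p) (snd p)"
      using that by (auto simp: primitive_wedge_def)
    then have "coprime (snd p) (s\<^sup>2)"
      using coprime_snd_norm by simp
    then show ?thesis
      using exists_mod_sqrt_of_solution[OF p(1), of "s\<^sup>2"] assms by auto
  qed
  define f where "f p = (SOME r. r \<in> mod_sqrts 2 (s\<^sup>2) \<and> [fst p = r * snd p] (mod s\<^sup>2))" for p
  have f: "f p \<in> mod_sqrts 2 (s\<^sup>2)" "[fst p = f p * snd p] (mod s\<^sup>2)"
    if "p \<in> primitive_wedge s" for p
    using someI_ex[OF ex[OF that]] by (auto simp: f_def)
  have f2: "[(f p)\<^sup>2 = 2] (mod s\<^sup>2)" if "p \<in> primitive_wedge s" for p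
    using f(1)[OF that] by (simp add: mod_sqrts_def)
  have "bij_betw f (primitive_wedge s) (mod_sqrts 2 (s\<^sup>2))"
    unfolding bij_betw_def
  proof
    show "inj_on f (primitive_wedge s)"
    proof (rule inj_onI)
      fix p q assume pq: "p \<in> primitive_wedge s" "q \<in> primitive_wedge s" "f p = f q"
      then show "p = q"
        using primitive_wedge_unique[of s "fst p" "snd p" "fst q" "snd q" "f p"]
          f(2)[of p] f(2)[of q] f2[of p] assms by (auto simp: prod_eq_iff)
    qed
    show "f ` primitive_wedge s = mod_sqrts 2 (s\<^sup>2)"
    proof (intro equalityI subsetI)
      fix r assume r: "r \<in> mod_sqrts 2 (s\<^sup>2)"
      then obtain X Y where XY: "(X, Y) \<in> primitive_wedge s" "[X = r * Y] (mod s\<^sup>2)"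
        using exists_primitive_wedge_of_mod_sqrt[of s r] assms by (auto simp: mod_sqrts_def)
      have "coprime Y (s\<^sup>2)"
        using XY coprime_snd_norm by (auto simp: primitive_wedge_def)
      moreover have "[f (X, Y) * Y = r * Y] (mod s\<^sup>2)"
        using f(2)[OF XY(1)] XY(2) by (auto intro: cong_trans cong_sym)
      ultimately have "[f (X, Y) = r] (mod s\<^sup>2)"
        using cong_mult_rcancel by blast
      then have "f (X, Y) = r"
        using mod_sqrts_eqI f(1)[OF XY(1)] r by blast
      then show "r \<in> f ` primitive_wedge s"
        using XY by blast
    qed (use f in auto)
  qed
  then show ?thesis
    by (rule bij_betw_same_card)
qed


section \<open>Admissible right-hand sides and the number of solutions\<close>

text \<open>
  An odd prime divisor \<open>p\<close> of \<open>s\<close> does not divide \<open>Y\<close>, so \<open>X / Y\<close> is a square root of \<open>2\<close> modulo \<open>p\<close>.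
  The prime \<open>2\<close> is excluded modulo \<open>4\<close>: if \<open>s\<close> is even, then so is \<open>X\<close>, while \<open>Y\<close> is odd, and
  \<open>X\<^sup>2 + s\<^sup>2 \<equiv> 0\<close> but \<open>2 * Y\<^sup>2 \<equiv> 2\<close>.
\<close>

lemma A058529_of_primitive_solution:
  fixes X Y :: int and s :: nat
  assumes eq: "X\<^sup>2 - 2 * Y\<^sup>2 = - (int s)\<^sup>2" and cop: "coprime X Y" and "s > 0"
  shows "s \<in> A058529"
  unfolding A058529_def
proof (intro CollectI conjI allI impI)
  fix p :: nat assume p: "prime p \<and> p dvd s"
  then have dvd: "int p dvd (int s)\<^sup>2"
    by (simp add: power2_eq_square)
  have "coprime Y (int p)"
    using coprime_snd_norm[OF eq cop] p by (meson coprime_divisors dvd_refl int_dvd_int_iff)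
  moreover have "int p > 0"
    using p by (simp add: prime_gt_0_nat)
  ultimately obtain r where r: "r \<in> mod_sqrts 2 (int p)"
    using exists_mod_sqrt_of_solution[OF eq _ dvd] by blast
  have "p \<noteq> 2"
  proof
    assume "p = 2"
    then have "even s" "odd Y"
      using p \<open>coprime Y (int p)\<close> by auto
    moreover have "even (X\<^sup>2)"
    proof -
      have "X\<^sup>2 = 2 * Y\<^sup>2 - (int s)\<^sup>2"
        using eq by simp
      then show ?thesis
        using \<open>even s\<close> by simp
    qed
    ultimately obtain a b c where "X = 2 * a" "int s = 2 * b" "Y = 2 * c + 1"
      by (auto elim!: evenE oddE)
    then have "4 * a\<^sup>2 + 4 * b\<^sup>2 = 2 * (4 * c\<^sup>2 + 4 * c + 1)"
      using eq by (simp add: power2_eq_square algebra_simps)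
    then show False
      by presburger
  qed
  then have "p > 2"
    using p prime_ge_2_nat[of p] by simp
  moreover have "QuadRes (int p) 2"
    using r by (auto simp: QuadRes_def mod_sqrts_def)
  ultimately show "p mod 8 = 1 \<or> p mod 8 = 7"
    using QuadRes_2_iff p by blast
qed fact

lemma odd_of_A058529:
  assumes "s \<in> A058529"
  shows "odd s"
proof
  assume "even s"
  then have "(2 :: nat) mod 8 = 1 \<or> (2 :: nat) mod 8 = 7"
    using assms two_is_prime_nat unfolding A058529_def by blast
  then show False
    by simp
qed

lemma prime_factors_A058529_nonempty:
  assumes "s \<in> A058529" "s \<noteq> 1"
  shows "card (prime_factors s) > 0"
proof -
  have "s \<noteq> 0"
    using assms by (simp add: A058529_def)
  then obtain p where "prime p" "p dvd s"
    using assms prime_factor_nat by blast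
  then have "p \<in> prime_factors s"
    using \<open>s \<noteq> 0\<close> by (simp add: in_prime_factors_iff)
  then show ?thesis
    by (auto simp: card_gt_0_iff)
qed

lemma proper_restricted_solutions_eq:
  "proper_restricted_solutions s = {(X, Y) \<in> primitive_wedge (int s). X > 0}"
  by (auto simp: proper_restricted_solutions_def restricted_solutions_def pell_solutions_def
      primitive_wedge_def proper_def coprime_iff_gcd_eq_1)

text \<open>
  The wedge is symmetric under \<open>X \<mapsto> - X\<close>, and it has no point with \<open>X = 0\<close>, as \<open>\<surd>2\<close> is irrational;
  the restricted solutions are one of its two halves.
\<close>

lemma card_proper_restricted_solutions:
  assumes s: "s \<in> A058529" "s \<noteq> 1"
  shows "card (proper_restricted_solutions s) = 2 ^ (card (prime_factors s) - 1)"
proof -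
  define A where "A = proper_restricted_solutions s"
  define W where "W = primitive_wedge (int s)"
  define c :: "int \<times> int \<Rightarrow> int \<times> int" where "c = (\<lambda>(X, Y). (- X, Y))"
  have "s > 1"
    using s by (auto simp: A058529_def)
  have card_W: "card W = 2 ^ card (prime_factors s)"
    unfolding W_def using card_primitive_wedge[of "int s"] card_mod_sqrts_2_A058529[OF s(1)] \<open>s > 1\<close>
    by simp
  then have "finite W"
    by (metis card.infinite power_eq_0_iff zero_neq_numeral)
  have A: "A = {(X, Y) \<in> W. X > 0}"
    by (simp add: A_def W_def proper_restricted_solutions_eq)
  then have "finite A"
    using \<open>finite W\<close> by (auto intro: finite_subset)
  have "X \<noteq> 0" if "(X, Y) \<in> W" for X Y
  proof
    assume "X = 0"
    then have "(int s)\<^sup>2 = 2 * Y\<^sup>2" "Y > 0"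
      using that by (auto simp: W_def primitive_wedge_def)
    then show False
      using square_eq_two_times_square by force
  qed
  moreover have conj: "(- X, Y) \<in> W \<longleftrightarrow> (X, Y) \<in> W" for X Y
    by (simp add: W_def primitive_wedge_def)
  ultimately have "(X, Y) \<in> A \<or> (- X, Y) \<in> A" if "(X, Y) \<in> W" for X Y
    using that by (cases "X > 0") (fastforce simp: A)+
  then have "p \<in> A \<or> c p \<in> A" if "p \<in> W" for p
    using that by (auto simp: c_def split: prod.splits)
  moreover have "c (c p) = p" for p
    by (simp add: c_def split: prod.splits)
  ultimately have "W \<subseteq> A \<union> c ` A"
    by (metis UnI1 UnI2 image_eqI subsetI)
  moreover have "A \<union> c ` A \<subseteq> W"
    using conj by (auto simp: A c_def)
  ultimately have "W = A \<union> c ` A"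
    by blast
  moreover have "A \<inter> c ` A = {}"
    by (auto simp: A c_def)
  moreover have "card (c ` A) = card A"
    by (rule card_image) (auto simp: inj_on_def c_def)
  ultimately have "2 * card A = 2 ^ card (prime_factors s)"
    using card_W card_Un_disjoint[of A "c ` A"] \<open>finite A\<close> by simp
  also have "\<dots> = 2 * 2 ^ (card (prime_factors s) - 1)"
    using prime_factors_A058529_nonempty[OF s] by (simp flip: power_Suc)
  finally show ?thesis
    by (simp add: A_def)
qed

lemma restricted_solutions_1_empty: "restricted_solutions 1 = {}"
proof -
  have False if "X\<^sup>2 - 2 * Y\<^sup>2 = - 1" "0 < X" "X < Y" for X Y :: int
    using wedge_bound[of X Y 1] that by simp
  then show ?thesis
    by (auto simp: restricted_solutions_def pell_solutions_def)
qed

lemma proper_restricted_solutions_nonempty_iff: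
  assumes "s > 0"
  shows "proper_restricted_solutions s \<noteq> {} \<longleftrightarrow> s \<in> A058529 \<and> s \<noteq> 1"
proof
  assume *: "proper_restricted_solutions s \<noteq> {}"
  then have "s \<noteq> 1"
    using restricted_solutions_1_empty by (auto simp: proper_restricted_solutions_def)
  moreover have "s \<in> A058529"
    using * assms A058529_of_primitive_solution
    by (auto simp: proper_restricted_solutions_eq primitive_wedge_def)
  ultimately show "s \<in> A058529 \<and> s \<noteq> 1"
    by blast
next
  assume "s \<in> A058529 \<and> s \<noteq> 1"
  then have "card (proper_restricted_solutions s) \<noteq> 0"
    by (simp add: card_proper_restricted_solutions)
  then show "proper_restricted_solutions s \<noteq> {}"
    by auto
qed

lemma mem_A058529_not_1_iff: "s \<in> A058529 \<and> s \<noteq> 1 \<longleftrightarrow> (\<exists>n \<ge> 2. s = s_seq n)"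
proof
  assume s: "s \<in> A058529 \<and> s \<noteq> 1"
  then obtain n where n: "n \<ge> 1" "s = s_seq n"
    using range_s_seq by (metis imageE atLeast_iff)
  then have "n \<noteq> 1"
    using s s_seq_1 by auto
  then show "\<exists>n \<ge> 2. s = s_seq n"
    using n by (intro exI[of _ n]) auto
next
  assume "\<exists>n \<ge> 2. s = s_seq n"
  then obtain n where n: "n \<ge> 2" "s = s_seq n"
    by blast
  then have "s \<in> A058529"
    using range_s_seq by (metis atLeast_iff image_eqI one_le_numeral order_trans)
  moreover have "s > 1"
    using n s_seq_less[of 1 n] s_seq_1 by simp
  ultimately show "s \<in> A058529 \<and> s \<noteq> 1"
    by simp
qed

lemma P_total_eq:
  assumes "s_seq n \<in> A058529"
  shows "P_total n = 2 ^ (card (prime_factors (s_seq n)) - 1)"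
proof -
  define Q where "Q = (\<lambda>c. {p. prime p \<and> p dvd s_seq n \<and> p mod 8 = c})"
  have pos: "s_seq n > 0"
    using assms by (simp add: A058529_def)
  then have Q: "prime_factors (s_seq n) = Q 1 \<union> Q 7"
    using assms by (auto simp: Q_def A058529_def in_prime_factors_iff)
  then have "finite (Q 1)" "finite (Q 7)"
    by (metis finite_Un finite_set_mset)+
  moreover have "Q 1 \<inter> Q 7 = {}"
    by (auto simp: Q_def)
  ultimately have "card (prime_factors (s_seq n)) = P\<^sub>1 n + P\<^sub>7 n"
    unfolding Q by (simp add: card_Un_disjoint P\<^sub>1_def P\<^sub>7_def Q_def)
  then show ?thesis
    by (simp add: P_total_def)
qed

lemma odd_of_proper_restricted_solution:
  assumes "(X, Y) \<in> proper_restricted_solutions s" "odd s"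
  shows "odd X \<and> odd Y"
proof -
  have eq: "X\<^sup>2 - 2 * Y\<^sup>2 = - (int s)\<^sup>2"
    using assms by (auto simp: proper_restricted_solutions_eq primitive_wedge_def)
  have "X\<^sup>2 = 2 * Y\<^sup>2 - (int s)\<^sup>2"
    using eq by simp
  moreover have "odd (2 * Y\<^sup>2 - (int s)\<^sup>2)"
    using \<open>odd s\<close> by simp
  ultimately have "odd X"
    by (metis even_power pos2)
  moreover have "odd Y"
  proof
    assume "even Y"
    moreover have "odd (int s)"
      using \<open>odd s\<close> by simp
    ultimately obtain a b c where "X = 2 * a + 1" "int s = 2 * b + 1" "Y = 2 * c"
      using \<open>odd X\<close> by (auto elim!: evenE oddE)
    then have "(4 * a\<^sup>2 + 4 * a + 1) + (4 * b\<^sup>2 + 4 * b + 1) = 8 * c\<^sup>2"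
      using eq by (simp add: power2_eq_square algebra_simps)
    then show False
      by presburger
  qed
  ultimately show ?thesis ..
qed

text \<open>
  Dividing by \<open>g = gcd X Y\<close> gives a proper restricted solution for \<open>t = s / g\<close>. Therefore
  \<open>t \<noteq> 1\<close> has only admissible prime divisors, and \<open>s = g * t\<close> is a product of two numbers above one.
\<close>

lemma improper_restricted_solutions_imp:
  assumes "improper_restricted_solutions s \<noteq> {}" "s > 0"
  shows "s > 1 \<and> \<not> prime s \<and> (\<exists>p. prime p \<and> p dvd s \<and> (p mod 8 = 1 \<or> p mod 8 = 7))"
proof -
  obtain X Y where XY: "X\<^sup>2 - 2 * Y\<^sup>2 = - (int s)\<^sup>2" "0 < X" "X < Y" "gcd X Y \<noteq> 1"
    using assms by (auto simp: improper_restricted_solutions_def restricted_solutions_def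
        pell_solutions_def proper_def)
  define g where "g = nat (gcd X Y)"
  have g: "int g = gcd X Y" "g > 1"
    using XY gcd_pos_int[of X Y] by (auto simp: g_def simp del: gcd_pos_int)
  have "gcd X Y \<noteq> 0"
    using XY by simp
  then obtain x y where "X = x * gcd X Y" "Y = y * gcd X Y" "coprime x y"
    using gcd_coprime_exists by blast
  note xy = this[folded g(1)]
  have norm: "(int s)\<^sup>2 = (int g)\<^sup>2 * (2 * y\<^sup>2 - x\<^sup>2)"
    using XY(1) by (simp add: xy power_mult_distrib algebra_simps)
  then have "(int g)\<^sup>2 dvd (int s)\<^sup>2"
    by simp
  then have "g dvd s"
    by simp
  then obtain t where t: "s = g * t" ..
  have "t > 0"
    using t assms by auto
  have "2 * y\<^sup>2 - x\<^sup>2 = (int t)\<^sup>2"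
    using norm g(2) by (simp add: t power_mult_distrib)
  then have "(x, y) \<in> proper_restricted_solutions t"
    using xy XY g(2) by (auto simp: proper_restricted_solutions_eq primitive_wedge_def zero_less_mult_iff)
  then have t': "t \<in> A058529" "t \<noteq> 1"
    using proper_restricted_solutions_nonempty_iff[OF \<open>t > 0\<close>] by auto
  then obtain p where p: "prime p" "p dvd t"
    using prime_factor_nat by blast
  then have "p mod 8 = 1 \<or> p mod 8 = 7"
    using t' by (simp add: A058529_def)
  moreover have "p dvd s"
    using p t by simp
  moreover have "\<not> prime s"
    using t g(2) t'(2) prime_product[of g t] by auto
  moreover have "s \<noteq> 1"
    using t g(2) by auto
  ultimately show ?thesis
    using p assms by auto
qed

section \<open>The single family for norm minus one\<close>

text \<open>
  An abbreviation, because the prefix \<open>inv\<close> denotes the inverse in a group here.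
\<close>

abbreviation pell_map_inv :: "int \<times> int \<Rightarrow> int \<times> int" where
  "pell_map_inv \<equiv> inv_into UNIV pell_map"

lemma pell_map_pell_map_inv: "pell_map (pell_map_inv q) = q"
  by (rule surj_f_inv_f) (rule bij_is_surj[OF bij_pell_map])

text \<open>
  The equation is preserved because \<open>3 + 2 * \<surd>2\<close> has norm one; the sign of \<open>Y\<close> is preserved because
  \<open>4 * X\<^sup>2 \<le> 8 * Y\<^sup>2 < 9 * Y\<^sup>2\<close> makes \<open>3 * Y\<close> dominate \<open>2 * \<bar>X\<bar>\<close>.
\<close>

lemma pell_map_pell_solutions:
  assumes "p \<in> pell_solutions s"
  shows "pell_map p \<in> pell_solutions s" "pell_map_inv p \<in> pell_solutions s"
proof -
  obtain X Y where p: "p = (X, Y)" and eq: "X\<^sup>2 - 2 * Y\<^sup>2 = - (int s)\<^sup>2" and "Y > 0"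
    using assms by (auto simp: pell_solutions_def)
  have "(2 * \<bar>X\<bar>)\<^sup>2 < (3 * Y)\<^sup>2"
  proof -
    have "(2 * \<bar>X\<bar>)\<^sup>2 = 8 * Y\<^sup>2 - 4 * (int s)\<^sup>2" "(3 * Y)\<^sup>2 = 9 * Y\<^sup>2"
      using eq by (simp_all add: power_mult_distrib)
    moreover have "Y\<^sup>2 > 0" "(int s)\<^sup>2 \<ge> 0"
      using \<open>Y > 0\<close> by simp_all
    ultimately show ?thesis
      by linarith
  qed
  then have "2 * \<bar>X\<bar> < 3 * Y"
    using \<open>Y > 0\<close> by (intro power2_less_imp_less[of "2 * \<bar>X\<bar>"]) auto
  then show "pell_map p \<in> pell_solutions s" "pell_map_inv p \<in> pell_solutions s"
    unfolding inv_pell_map using eq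
    by (auto simp: p pell_map_def pell_solutions_def power2_eq_square algebra_simps)
qed

lemma pell_map_power_pell_solutions:
  assumes "p \<in> pell_solutions s"
  shows "pell_map_power k p \<in> pell_solutions s"
proof -
  have "(pell_map ^^ n) p \<in> pell_solutions s \<and> (pell_map_inv ^^ n) p \<in> pell_solutions s" for n
    by (induction n) (use assms pell_map_pell_solutions in auto)
  then show ?thesis
    by (simp add: pell_map_power_def)
qed

lemma pell_map_power_0 [simp]: "pell_map_power 0 p = p"
  by (simp add: pell_map_power_def)

lemma pell_map_power_plus_1: "pell_map_power (k + 1) p = pell_map (pell_map_power k p)"
proof (cases "k \<ge> 0")
  case True
  then have "nat (k + 1) = Suc (nat k)"
    by simp
  then show ?thesis
    using True by (simp add: pell_map_power_def)
next
  case False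
  then have "nat (- k) = Suc (nat (- (k + 1)))"
    by simp
  then have "pell_map_power k p = pell_map_inv ((pell_map_inv ^^ nat (- (k + 1))) p)"
    using False by (simp add: pell_map_power_def)
  then have "pell_map (pell_map_power k p) = (pell_map_inv ^^ nat (- (k + 1))) p"
    by (simp add: pell_map_pell_map_inv)
  then show ?thesis
    using False by (auto simp: pell_map_power_def)
qed

lemma pell_map_in_orbit_iff:
  "pell_map q \<in> range (\<lambda>k. pell_map_power k p) \<longleftrightarrow> q \<in> range (\<lambda>k. pell_map_power k p)"
proof
  assume "pell_map q \<in> range (\<lambda>k. pell_map_power k p)"
  then obtain k where "pell_map q = pell_map_power k p"
    by blast
  then have "pell_map q = pell_map (pell_map_power (k - 1) p)"
    using pell_map_power_plus_1[of "k - 1"] by simp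
  then have "q = pell_map_power (k - 1) p"
    by (rule injD[OF bij_is_inj[OF bij_pell_map]])
  then show "q \<in> range (\<lambda>k. pell_map_power k p)"
    by blast
next
  assume "q \<in> range (\<lambda>k. pell_map_power k p)"
  then show "pell_map q \<in> range (\<lambda>k. pell_map_power k p)"
    by (force simp flip: pell_map_power_plus_1)
qed

text \<open>
  Descent: a solution with \<open>Y > 1\<close> has \<open>\<bar>X\<bar> > Y\<close>, so applying the map (for \<open>X < 0\<close>) or its inverse
  (for \<open>X > 0\<close>) strictly decreases \<open>Y\<close>. Stating this for an arbitrary invariant set \<open>S\<close> yields both
  directions at once: an orbit that contains a solution contains \<open>(1, 1)\<close>, and an orbit that
  contains \<open>(1, 1)\<close> contains every solution.
\<close>

lemma invariant_set_mem_iff: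
  assumes inv: "\<And>q. pell_map q \<in> S \<longleftrightarrow> q \<in> S"
  shows "p \<in> pell_solutions 1 \<Longrightarrow> p \<in> S \<longleftrightarrow> (1, 1) \<in> S"
proof (induction "nat (snd p)" arbitrary: p rule: less_induct)
  case less
  have inv': "pell_map_inv q \<in> S \<longleftrightarrow> q \<in> S" for q
    using inv[of "pell_map_inv q"] by (simp add: pell_map_pell_map_inv)
  obtain X Y where p: "p = (X, Y)" and eq: "X\<^sup>2 - 2 * Y\<^sup>2 = - 1" and "Y > 0"
    using less.prems by (auto simp: pell_solutions_def)
  show ?case
  proof (cases "Y = 1")
    case True
    then have "X = 1 \<or> X = - 1"
      using eq by (simp add: power2_eq_1_iff)
    moreover have "pell_map_inv (1, 1) = (- 1, 1)"
      by (simp add: inv_pell_map)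
    ultimately show ?thesis
      using inv'[of "(1, 1)"] True p by auto
  next
    case False
    then have "1\<^sup>2 < Y\<^sup>2"
      using \<open>Y > 0\<close> by (intro power_strict_mono) auto
    then have "Y\<^sup>2 < \<bar>X\<bar>\<^sup>2"
      using eq by simp
    then have XY: "Y < \<bar>X\<bar>"
      by (rule power2_less_imp_less) simp
    show ?thesis
    proof (cases "X > 0")
      case True
      have "snd (pell_map_inv p) < Y"
        using True XY by (simp add: inv_pell_map p)
      then show ?thesis
        using less.hyps[of "pell_map_inv p"] pell_map_pell_solutions(2)[OF less.prems] \<open>Y > 0\<close> inv' p
        by auto
    next
      case False
      have "snd (pell_map p) < Y"
        using False XY by (simp add: pell_map_def p)
      then show ?thesis
        using less.hyps[of "pell_map p"] pell_map_pell_solutions(1)[OF less.prems] \<open>Y > 0\<close> inv p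
        by auto
    qed
  qed
qed

lemma orbit_eq_pell_solutions_1:
  assumes p: "p \<in> pell_solutions 1"
  shows "range (\<lambda>k. pell_map_power k p) = pell_solutions 1"
proof
  show "range (\<lambda>k. pell_map_power k p) \<subseteq> pell_solutions 1"
    using pell_map_power_pell_solutions[OF p] by blast
  have "p \<in> range (\<lambda>k. pell_map_power k p)"
    using pell_map_power_0 by (metis rangeI)
  then show "pell_solutions 1 \<subseteq> range (\<lambda>k. pell_map_power k p)"
    using invariant_set_mem_iff[OF pell_map_in_orbit_iff] p by blast
qed

lemma families_1: "families 1 = {pell_solutions 1}"
proof -
  have "(1, 1) \<in> pell_solutions 1" "proper (1, 1)"
    by (simp_all add: pell_solutions_def proper_def)
  then show ?thesis
    unfolding families_def using orbit_eq_pell_solutions_1 by blast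
qed

lemma ambiguous_pell_solutions: "ambiguous (pell_solutions s)"
  unfolding ambiguous_def conjugate_def
proof (intro equalityI subsetI)
  fix p assume "p \<in> pell_solutions s"
  then show "p \<in> (\<lambda>(X, Y). (- X, Y)) ` pell_solutions s"
    by (intro image_eqI[of _ _ "(- fst p, snd p)"]) (auto simp: pell_solutions_def)
qed (auto simp: pell_solutions_def)

lemma positive_solution_1:
  assumes "(X, Y) \<in> pell_solutions 1" "positive (X, Y)" "(X, Y) \<noteq> (1, 1)"
  shows "X > Y"
proof (rule ccontr)
  assume "\<not> X > Y"
  moreover have eq: "X\<^sup>2 - 2 * Y\<^sup>2 = - (1\<^sup>2)" and "X > 0" "Y > 0"
    using assms by (auto simp: pell_solutions_def Defs.positive_def)
  ultimately have "X = Y"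
    using wedge_bound[OF eq] by force
  then have "X = 1"
    using eq \<open>X > 0\<close> by (simp add: power2_eq_1_iff)
  then show False
    using \<open>X = Y\<close> assms by simp
qed

theorem proposition7:
  shows "(\<forall>s > 0. proper_restricted_solutions s \<noteq> {} \<longleftrightarrow> (\<exists>n \<ge> 2. s = s_seq n))
    \<and> (\<forall>n \<ge> 2. odd (s_seq n)
          \<and> (\<forall>(X, Y) \<in> proper_restricted_solutions (s_seq n). odd X \<and> odd Y)
          \<and> card (proper_restricted_solutions (s_seq n)) = P_total n)
    \<and> (\<forall>s > 0. improper_restricted_solutions s \<noteq> {} \<longrightarrow>
          s > 1 \<and> \<not> prime s \<and>
          (\<exists>p. prime p \<and> p dvd s \<and> (p mod 8 = 1 \<or> p mod 8 = 7)))
    \<and> restricted_solutions 1 = {}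
    \<and> (\<exists>F. families 1 = {F} \<and> ambiguous F \<and> positive_fundamental F (1, 1))
    \<and> (\<forall>(X, Y) \<in> pell_solutions 1. positive (X, Y) \<and> (X, Y) \<noteq> (1, 1) \<longrightarrow> X > Y \<and> Y > 0)"
proof (intro conjI)
  show "\<forall>s > 0. proper_restricted_solutions s \<noteq> {} \<longleftrightarrow> (\<exists>n \<ge> 2. s = s_seq n)"
    using proper_restricted_solutions_nonempty_iff mem_A058529_not_1_iff by simp
  show "\<forall>n \<ge> 2. odd (s_seq n)
          \<and> (\<forall>(X, Y) \<in> proper_restricted_solutions (s_seq n). odd X \<and> odd Y)
          \<and> card (proper_restricted_solutions (s_seq n)) = P_total n"
  proof (intro allI impI)
    fix n :: nat assume "n \<ge> 2"
    then have s: "s_seq n \<in> A058529" "s_seq n \<noteq> 1"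
      using mem_A058529_not_1_iff[of "s_seq n"] by blast+
    then show "odd (s_seq n)
          \<and> (\<forall>(X, Y) \<in> proper_restricted_solutions (s_seq n). odd X \<and> odd Y)
          \<and> card (proper_restricted_solutions (s_seq n)) = P_total n"
      using odd_of_A058529[OF s(1)] odd_of_proper_restricted_solution
      by (auto simp: P_total_eq card_proper_restricted_solutions)
  qed
  show "\<forall>s > 0. improper_restricted_solutions s \<noteq> {} \<longrightarrow>
          s > 1 \<and> \<not> prime s \<and>
          (\<exists>p. prime p \<and> p dvd s \<and> (p mod 8 = 1 \<or> p mod 8 = 7))"
    using improper_restricted_solutions_imp by blast
  show "restricted_solutions 1 = {}"
    by (rule restricted_solutions_1_empty)
  have "positive_fundamental (pell_solutions 1) (1, 1)"
    by (auto simp: positive_fundamental_def pell_solutions_def Defs.positive_def)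
  then show "\<exists>F. families 1 = {F} \<and> ambiguous F \<and> positive_fundamental F (1, 1)"
    using families_1 ambiguous_pell_solutions by blast
  show "\<forall>(X, Y) \<in> pell_solutions 1. positive (X, Y) \<and> (X, Y) \<noteq> (1, 1) \<longrightarrow> X > Y \<and> Y > 0"
    using positive_solution_1 by (auto simp: Defs.positive_def)
qed

end
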